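(* Consider the semi-discrete central-upwind scheme $\frac{d}{dt}\overline{\mathbf U}_i=-\frac{\mathcal F_{i+1/2}-\mathcal F_{i-1/2}}{\Delta x}+\overline{\mathbf S}_i$ for the stochastic Galerkin shallow water system, as described in the context. If the source term is chosen as $$\overline{\mathbf S}_i=\begin{pmatrix}\mathbf 0\\-\frac{1}{\Delta x}\,g\,\mathcal{P}(\overline{\mathbf h}_i)\left(\mathbf B_{i+\frac12}-\mathbf B_{i-\frac12}\right)\end{pmatrix},$$ then the scheme is well-balanced: whenever at some time $t$ there is a constant vector $\mathbf w^*\in\mathbb{R}^K$ with $\overline{\mathbf h}_i+\overline{\mathbf B}_i=\mathbf w^*$ and $\overline{\mathbf q}_i=\mathbf 0$ for all cells $i$ (and $\mathcal{P}(\mathbf w^*-\mathbf B_{i+1/2})$ is positive definite at every interface), the right-hand side of the scheme vanishes, i.e. $\frac{d}{dt}\overline{\mathbf U}_i=\mathbf 0$ for all $i$.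
   Context: Let $\rho:\mathbb{R}^d\to\mathbb{R}$ be a (Lebesgue) probability density with finite polynomial moments of all orders and $\langle f,g\rangle_\rho=\int_{\mathbb{R}^d} f g\,\rho\,ds$. Let $\Lambda\subset\mathbb{N}_0^d$ be finite with $0\in\Lambda$, $|\Lambda|=K$, $P_\Lambda=\mathrm{span}\{\zeta^\nu:\nu\in\Lambda\}$, and let $\phi_1\equiv1,\dots,\phi_K$ be an $L^2_\rho$-orthonormal basis of $P_\Lambda$. For $\hat y\in\mathbb{R}^K$ let $\mathcal{P}(\hat y)=\sum_{k=1}^K\hat y_k\mathcal{M}_k$, $(\mathcal{M}_k)_{\ell m}=\langle\phi_k,\phi_\ell\phi_m\rangle_\rho$. Let $g>0$. For $\hat U=(\hat h,\hat q)\in\mathbb{R}^{2K}$ with $\mathcal{P}(\hat h)$ invertible let $$F(\hat U)=\begin{pmatrix}\hat q\\ \tfrac12 g\mathcal{P}(\hat h)\hat h+\mathcal{P}(\hat q)\mathcal{P}^{-1}(\hat h)\hat q\end{pmatrix},\qquad J(\hat U)=\frac{\partial F}{\partial\hat U}=\begin{pmatrix}O&I\\ g\mathcal{P}(\hat h)-\mathcal{P}(\hat q)\mathcal{P}^{-1}(\hat h)\mathcal{P}(\hat u)&\mathcal{P}(\hat u)+\mathcal{P}(\hat q)\mathcal{P}^{-1}(\hat h)\end{pmatrix},$$ with $\hat u=\mathcal{P}^{-1}(\hat h)\hat q$. When $\mathcal{P}(\hat h)$ is positive definite, $J(\hat U)$ has real eigenvalues $\lambda_1\le\dots\le\lambda_{2K}$.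 The stochastic Galerkin shallow water system is $\hat U_t+F(\hat U)_x=(0,-g\mathcal{P}(\hat h)\hat B_x)^T$. Mesh and data: uniform cells $\mathcal C_i=[x_{i-1/2},x_{i+1/2}]$ of length $\Delta x$, $i=1,\dots,N$, together with ghost cells beyond each end of the domain sufficient to define the reconstructions ("all cells" includes these). The unknowns are the cell averages $\overline{\mathbf U}_i=(\overline{\mathbf h}_i,\overline{\mathbf q}_i)\in\mathbb{R}^{2K}$. The bottom coefficient vector $\hat B$ is replaced by its continuous piecewise linear interpolant with interface values $\mathbf B_{i+1/2}\in\mathbb{R}^K$ (the coefficient vector of the $P_\Lambda$-projection of $B(x_{i+1/2},\cdot)$), so its cell averages are $\overline{\mathbf B}_i=\frac12(\mathbf B_{i+1/2}+\mathbf B_{i-1/2})$. Reconstruction: put $\overline{\mathbf w}_i=\overline{\mathbf h}_i+\overline{\mathbf B}_i$. For $\mathbf V\in\{\mathbf w,\mathbf q\}$ set (componentwise) $(\mathbf V_x)_i=\mathrm{minmod}\left(\theta\frac{\overline{\mathbf V}_{i+1}-\overline{\mathbf V}_i}{\Delta x},\frac{\overline{\mathbf V}_{i+1}-\overline{\mathbf V}_{i-1}}{2\Delta x},\theta\frac{\overline{\mathbf V}_i-\overline{\mathbf V}_{i-1}}{\Delta x}\right)$ with $\theta\in[1,2]$, where $\mathrm{minmod}$ returns the minimum of its arguments if all are positive, the maximum if all are negative, and $0$ otherwise; and $\mathbf V^+_{i-1/2}=\overline{\mathbf V}_i-\frac{\Delta x}{2}(\mathbf V_x)_i$, $\mathbf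 V^-_{i+1/2}=\overline{\mathbf V}_i+\frac{\Delta x}{2}(\mathbf V_x)_i$. Then $\mathbf h^\pm_{i+1/2}=\mathbf w^\pm_{i+1/2}-\mathbf B_{i+1/2}$ and $\mathbf U^\pm_{i+1/2}=(\mathbf h^\pm_{i+1/2},\mathbf q^\pm_{i+1/2})$. Local speeds: $a^-_{i+1/2}=\min\{\lambda_1(J(\mathbf U^-_{i+1/2})),\lambda_1(J(\mathbf U^+_{i+1/2})),0\}$ and $a^+_{i+1/2}=\max\{\lambda_{2K}(J(\mathbf U^-_{i+1/2})),\lambda_{2K}(J(\mathbf U^+_{i+1/2})),0\}$. Numerical flux: $$\mathcal F_{i+\frac12}=\frac{a^+_{i+\frac12}F(\mathbf U^-_{i+\frac12})-a^-_{i+\frac12}F(\mathbf U^+_{i+\frac12})}{a^+_{i+\frac12}-a^-_{i+\frac12}}+\frac{a^+_{i+\frac12}a^-_{i+\frac12}}{a^+_{i+\frac12}-a^-_{i+\frac12}}\left[\mathbf U^+_{i+\frac12}-\mathbf U^-_{i+\frac12}\right].$$ *)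

theory Defs
  imports "HOL-Analysis.Analysis"
begin

section \<open>Polynomial chaos basis and Galerkin matrices\<close>

definition monomial :: "('d::finite \<Rightarrow> nat) \<Rightarrow> real ^ 'd \<Rightarrow> real" where
  "monomial \<nu> s = (\<Prod>j\<in>UNIV. (s $ j) ^ \<nu> j)"

definition density_with_moments :: "(real ^ 'd::finite \<Rightarrow> real) \<Rightarrow> bool" where
  "density_with_moments \<rho> \<longleftrightarrow>
     (\<forall>s. 0 \<le> \<rho> s) \<and> has_bochner_integral lebesgue \<rho> 1 \<and>
     (\<forall>\<nu>. integrable lebesgue (\<lambda>s. monomial \<nu> s * \<rho> s))"

definition rho_inner ::
    "(real ^ 'd::finite \<Rightarrow> real) \<Rightarrow> (real ^ 'd \<Rightarrow> real) \<Rightarrow> (real ^ 'd \<Rightarrow> real) \<Rightarrow> real" where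
  "rho_inner \<rho> f h = (LINT s|lebesgue. f s * h s * \<rho> s)"

definition poly_space :: "('d::finite \<Rightarrow> nat) set \<Rightarrow> (real ^ 'd \<Rightarrow> real) set" where
  "poly_space \<Lambda> = {f. \<exists>c. f = (\<lambda>s. \<Sum>\<nu>\<in>\<Lambda>. c \<nu> * monomial \<nu> s)}"

text \<open>The basis is indexed by a finite type \<open>'k\<close> with \<open>K = CARD('k)\<close> elements.\<close>

definition orthonormal_basis_of ::
    "(real ^ 'd::finite \<Rightarrow> real) \<Rightarrow> ('d \<Rightarrow> nat) set \<Rightarrow> ('k::finite \<Rightarrow> real ^ 'd \<Rightarrow> real) \<Rightarrow> bool" where
  "orthonormal_basis_of \<rho> \<Lambda> \<phi> \<longleftrightarrow>
     (\<forall>k. \<phi> k \<in> poly_space \<Lambda>) \<and>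
     (\<forall>f\<in>poly_space \<Lambda>. \<exists>c. f = (\<lambda>s. \<Sum>k\<in>UNIV. c k * \<phi> k s)) \<and>
     (\<forall>k l. rho_inner \<rho> (\<phi> k) (\<phi> l) = (if k = l then 1 else 0))"

definition galerkin_matrix ::
    "(real ^ 'd::finite \<Rightarrow> real) \<Rightarrow> ('k::finite \<Rightarrow> real ^ 'd \<Rightarrow> real) \<Rightarrow> real ^ 'k \<Rightarrow> real ^ 'k ^ 'k" where
  "galerkin_matrix \<rho> \<phi> y =
     (\<Sum>k\<in>UNIV. y $ k *\<^sub>R (\<chi> l m. rho_inner \<rho> (\<phi> k) (\<lambda>s. \<phi> l s * \<phi> m s)))"

definition proj_coeffs ::
    "(real ^ 'd::finite \<Rightarrow> real) \<Rightarrow> ('k::finite \<Rightarrow> real ^ 'd \<Rightarrow> real) \<Rightarrow> (real ^ 'd \<Rightarrow> real) \<Rightarrow> real ^ 'k" where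
  "proj_coeffs \<rho> \<phi> f = (\<chi> k. rho_inner \<rho> f (\<phi> k))"

text \<open>Applied only to Galerkin matrices, which are symmetric by construction.\<close>

definition positive_definite :: "real ^ 'n ^ 'n::finite \<Rightarrow> bool" where
  "positive_definite A \<longleftrightarrow> (\<forall>v. v \<noteq> 0 \<longrightarrow> 0 < v \<bullet> (A *v v))"


section \<open>Flux and flux Jacobian\<close>

text \<open>States \<open>(h, q)\<close> are vectors indexed by \<open>'k + 'k\<close>. From here on \<open>P\<close> stands for the map
  \<open>galerkin_matrix \<rho> \<phi>\<close>.\<close>

definition stack :: "real ^ 'k::finite \<Rightarrow> real ^ 'k \<Rightarrow> real ^ ('k + 'k)" where
  "stack h q = (\<chi> i. case i of Inl k \<Rightarrow> h $ k | Inr k \<Rightarrow> q $ k)"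

definition hpart :: "real ^ ('k::finite + 'k) \<Rightarrow> real ^ 'k" where
  "hpart U = (\<chi> k. U $ Inl k)"

definition qpart :: "real ^ ('k::finite + 'k) \<Rightarrow> real ^ 'k" where
  "qpart U = (\<chi> k. U $ Inr k)"

definition block_matrix ::
    "real ^ 'k ^ 'k::finite \<Rightarrow> real ^ 'k ^ 'k \<Rightarrow> real ^ 'k ^ 'k \<Rightarrow> real ^ 'k ^ 'k
      \<Rightarrow> real ^ ('k + 'k) ^ ('k + 'k)" where
  "block_matrix A B C D =
     (\<chi> i j. case i of
         Inl a \<Rightarrow> (case j of Inl b \<Rightarrow> A $ a $ b | Inr b \<Rightarrow> B $ a $ b)
       | Inr a \<Rightarrow> (case j of Inl b \<Rightarrow> C $ a $ b | Inr b \<Rightarrow> D $ a $ b))"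

definition swe_flux ::
    "(real ^ 'k::finite \<Rightarrow> real ^ 'k ^ 'k) \<Rightarrow> real \<Rightarrow> real ^ ('k + 'k) \<Rightarrow> real ^ ('k + 'k)" where
  "swe_flux P g U =
     (let h = hpart U; q = qpart U in
      stack q ((g / 2) *\<^sub>R (P h *v h) + P q *v (matrix_inv (P h) *v q)))"

text \<open>The derivative of \<open>swe_flux P g\<close> where \<open>P h\<close> is invertible. The lower left block uses that
  \<open>P\<close> is linear and \<open>P a *v b = P b *v a\<close>.\<close>

definition swe_jacobian ::
    "(real ^ 'k::finite \<Rightarrow> real ^ 'k ^ 'k) \<Rightarrow> real \<Rightarrow> real ^ ('k + 'k) \<Rightarrow> real ^ ('k + 'k) ^ ('k + 'k)" where
  "swe_jacobian P g U =
     (let h = hpart U; q = qpart U; u = matrix_inv (P h) *v q in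
      block_matrix 0 (mat 1)
        (g *\<^sub>R P h - P q ** matrix_inv (P h) ** P u)
        (P u + P q ** matrix_inv (P h)))"

text \<open>When all eigenvalues of a matrix are real, as for the flux Jacobian at a state with positive
  definite \<open>P h\<close>, the \<open>Min\<close> and \<open>Max\<close> of its real spectrum are its first and last eigenvalue in
  increasing order. They are unspecified for an empty spectrum.\<close>

definition real_spectrum :: "real ^ 'n ^ 'n::finite \<Rightarrow> real set" where
  "real_spectrum A = {\<mu>. \<exists>v. v \<noteq> 0 \<and> A *v v = \<mu> *\<^sub>R v}"

definition smallest_eigenvalue :: "real ^ 'n ^ 'n::finite \<Rightarrow> real" where
  "smallest_eigenvalue A = Min (real_spectrum A)"

definition largest_eigenvalue :: "real ^ 'n ^ 'n::finite \<Rightarrow> real" where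
  "largest_eigenvalue A = Max (real_spectrum A)"


section \<open>Central-upwind scheme\<close>

text \<open>Cells are indexed by integers, and a quantity at the interface \<open>x\<^bsub>i+1/2\<^esub>\<close> between the
  cells \<open>i\<close> and \<open>i + 1\<close> carries the index \<open>i\<close>.\<close>

definition minmod :: "real \<Rightarrow> real \<Rightarrow> real \<Rightarrow> real" where
  "minmod a b c =
     (if 0 < a \<and> 0 < b \<and> 0 < c then min a (min b c)
      else if a < 0 \<and> b < 0 \<and> c < 0 then max a (max b c)
      else 0)"

definition slope :: "real \<Rightarrow> real \<Rightarrow> (int \<Rightarrow> real ^ 'k::finite) \<Rightarrow> int \<Rightarrow> real ^ 'k" where
  "slope \<theta> dx V i =
     (\<chi> k. minmod (\<theta> * ((V (i + 1) $ k - V i $ k) / dx))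
                  ((V (i + 1) $ k - V (i - 1) $ k) / (2 * dx))
                  (\<theta> * ((V i $ k - V (i - 1) $ k) / dx)))"

definition rec_minus :: "real \<Rightarrow> real \<Rightarrow> (int \<Rightarrow> real ^ 'k::finite) \<Rightarrow> int \<Rightarrow> real ^ 'k" where
  "rec_minus \<theta> dx V i = V i + (dx / 2) *\<^sub>R slope \<theta> dx V i"

definition rec_plus :: "real \<Rightarrow> real \<Rightarrow> (int \<Rightarrow> real ^ 'k::finite) \<Rightarrow> int \<Rightarrow> real ^ 'k" where
  "rec_plus \<theta> dx V i = V (i + 1) - (dx / 2) *\<^sub>R slope \<theta> dx V (i + 1)"

definition bottom_avg :: "(int \<Rightarrow> real ^ 'k::finite) \<Rightarrow> int \<Rightarrow> real ^ 'k" where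
  "bottom_avg B i = (1 / 2) *\<^sub>R (B i + B (i - 1))"

definition surface_avg ::
    "(int \<Rightarrow> real ^ 'k::finite) \<Rightarrow> (int \<Rightarrow> real ^ ('k + 'k)) \<Rightarrow> int \<Rightarrow> real ^ 'k" where
  "surface_avg B U i = hpart (U i) + bottom_avg B i"

definition U_minus ::
    "real \<Rightarrow> real \<Rightarrow> (int \<Rightarrow> real ^ 'k::finite) \<Rightarrow> (int \<Rightarrow> real ^ ('k + 'k)) \<Rightarrow> int \<Rightarrow> real ^ ('k + 'k)" where
  "U_minus \<theta> dx B U i =
     stack (rec_minus \<theta> dx (surface_avg B U) i - B i) (rec_minus \<theta> dx (\<lambda>j. qpart (U j)) i)"

definition U_plus ::
    "real \<Rightarrow> real \<Rightarrow> (int \<Rightarrow> real ^ 'k::finite) \<Rightarrow> (int \<Rightarrow> real ^ ('k + 'k)) \<Rightarrow> int \<Rightarrow> real ^ ('k + 'k)" where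
  "U_plus \<theta> dx B U i =
     stack (rec_plus \<theta> dx (surface_avg B U) i - B i) (rec_plus \<theta> dx (\<lambda>j. qpart (U j)) i)"

definition speed_minus ::
    "(real ^ 'k::finite \<Rightarrow> real ^ 'k ^ 'k) \<Rightarrow> real \<Rightarrow> real ^ ('k + 'k) \<Rightarrow> real ^ ('k + 'k) \<Rightarrow> real" where
  "speed_minus P g Um Up =
     min (smallest_eigenvalue (swe_jacobian P g Um))
       (min (smallest_eigenvalue (swe_jacobian P g Up)) 0)"

definition speed_plus ::
    "(real ^ 'k::finite \<Rightarrow> real ^ 'k ^ 'k) \<Rightarrow> real \<Rightarrow> real ^ ('k + 'k) \<Rightarrow> real ^ ('k + 'k) \<Rightarrow> real" where
  "speed_plus P g Um Up =
     max (largest_eigenvalue (swe_jacobian P g Um))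
       (max (largest_eigenvalue (swe_jacobian P g Up)) 0)"

definition numerical_flux ::
    "(real ^ 'k::finite \<Rightarrow> real ^ 'k ^ 'k) \<Rightarrow> real \<Rightarrow> real \<Rightarrow> real \<Rightarrow> (int \<Rightarrow> real ^ 'k)
      \<Rightarrow> (int \<Rightarrow> real ^ ('k + 'k)) \<Rightarrow> int \<Rightarrow> real ^ ('k + 'k)" where
  "numerical_flux P g \<theta> dx B U i =
     (let Um = U_minus \<theta> dx B U i; Up = U_plus \<theta> dx B U i;
          am = speed_minus P g Um Up; ap = speed_plus P g Um Up in
      (1 / (ap - am)) *\<^sub>R (ap *\<^sub>R swe_flux P g Um - am *\<^sub>R swe_flux P g Up)
      + (ap * am / (ap - am)) *\<^sub>R (Up - Um))"

definition source_term ::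
    "(real ^ 'k::finite \<Rightarrow> real ^ 'k ^ 'k) \<Rightarrow> real \<Rightarrow> real \<Rightarrow> (int \<Rightarrow> real ^ 'k)
      \<Rightarrow> (int \<Rightarrow> real ^ ('k + 'k)) \<Rightarrow> int \<Rightarrow> real ^ ('k + 'k)" where
  "source_term P g dx B U i =
     stack 0 (- ((1 / dx) *\<^sub>R g *\<^sub>R (P (hpart (U i)) *v (B i - B (i - 1)))))"

definition scheme_rhs ::
    "(real ^ 'k::finite \<Rightarrow> real ^ 'k ^ 'k) \<Rightarrow> real \<Rightarrow> real \<Rightarrow> real \<Rightarrow> (int \<Rightarrow> real ^ 'k)
      \<Rightarrow> (int \<Rightarrow> real ^ ('k + 'k)) \<Rightarrow> int \<Rightarrow> real ^ ('k + 'k)" where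
  "scheme_rhs P g \<theta> dx B U i =
     - ((1 / dx) *\<^sub>R (numerical_flux P g \<theta> dx B U i - numerical_flux P g \<theta> dx B U (i - 1)))
     + source_term P g dx B U i"

text \<open>The evolution equations hold on the cells \<open>1, \<dots>, N\<close>; the values in the
  ghost cells \<open>-1, 0, N + 1, N + 2\<close>, which enter the fluxes at the interfaces \<open>0, \<dots>, N\<close> through the
  slopes, are unconstrained functions of time.\<close>

definition scheme_solution ::
    "(real ^ 'k::finite \<Rightarrow> real ^ 'k ^ 'k) \<Rightarrow> real \<Rightarrow> real \<Rightarrow> real \<Rightarrow> (int \<Rightarrow> real ^ 'k)
      \<Rightarrow> int \<Rightarrow> real set \<Rightarrow> (real \<Rightarrow> int \<Rightarrow> real ^ ('k + 'k)) \<Rightarrow> bool" where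
  "scheme_solution P g \<theta> dx B N T U \<longleftrightarrow>
     (\<forall>t\<in>T. \<forall>i\<in>{1..N}.
        ((\<lambda>\<tau>. U \<tau> i) has_vector_derivative scheme_rhs P g \<theta> dx B (U t) i) (at t within T))"

end

theory Submission
  imports Defs
begin

text \<open>At a lake at rest the slopes of \<open>w\<close> and \<open>q\<close> vanish, so both reconstructed states at an interface
  coincide and the numerical flux reduces to the exact flux \<open>(0, g/2 P(h) h)\<close> with \<open>h = w* - B\<close>. The
  flux difference over a cell then cancels the source term: since \<open>P(a) b = P(b) a\<close>, the difference
  \<open>P(a) a - P(b) b\<close> equals \<open>P(a + b) (a - b)\<close>, and the mean of the two interface values of \<open>h\<close> is its
  cell average. The reduction of the numerical flux needs \<open>a\<^sup>+ \<noteq> a\<^sup>-\<close>, as the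
  quotients would otherwise be \<open>0\<close> by the convention \<open>x / 0 = 0\<close>. At \<open>q = 0\<close> an eigenpair
  \<open>(\<mu>, x)\<close> of \<open>P(h)\<close> gives the eigenvalue \<open>sqrt (g \<mu>) > 0\<close> of the Jacobian.\<close>

section \<open>Spectra of symmetric matrices\<close>

lemma symmetric_matrix_inner:
  fixes A :: "real ^ 'n ^ 'n::finite"
  assumes "transpose A = A"
  shows "x \<bullet> (A *v y) = (A *v x) \<bullet> y"
  by (metis assms dot_lmul_matrix vector_transpose_matrix)

text \<open>Eigenvectors for distinct eigenvalues are orthogonal, so choosing one per eigenvalue
  gives an independent, hence finite, family.\<close>

lemma finite_real_spectrum_symmetric:
  fixes A :: "real ^ 'n ^ 'n::finite"
  assumes sym: "transpose A = A"
  shows "finite (real_spectrum A)"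
proof -
  have "\<forall>\<mu>\<in>real_spectrum A. \<exists>v. v \<noteq> 0 \<and> A *v v = \<mu> *\<^sub>R v"
    by (simp add: real_spectrum_def)
  then obtain v where v: "\<And>\<mu>. \<mu> \<in> real_spectrum A \<Longrightarrow> v \<mu> \<noteq> 0 \<and> A *v v \<mu> = \<mu> *\<^sub>R v \<mu>"
    by (auto dest!: bchoice)
  have orth: "v \<mu> \<bullet> v \<nu> = 0" if "\<mu> \<in> real_spectrum A" "\<nu> \<in> real_spectrum A" "\<mu> \<noteq> \<nu>" for \<mu> \<nu>
    using symmetric_matrix_inner[OF sym, of "v \<mu>" "v \<nu>"] v[OF that(1)] v[OF that(2)] that(3) by simp
  have inj: "inj_on v (real_spectrum A)"
    by (rule inj_onI) (metis inner_eq_zero_iff orth v)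
  have "pairwise orthogonal (v ` real_spectrum A)"
    by (auto simp: pairwise_def orthogonal_def intro: orth)
  moreover have "0 \<notin> v ` real_spectrum A"
    using v by force
  ultimately have "independent (v ` real_spectrum A)"
    by (rule pairwise_orthogonal_independent)
  then show ?thesis
    using inj independent_bound finite_imageD by blast
qed

text \<open>A zero of a nonnegative form is a minimum, so its gradient \<open>2 * A v\<close>
  vanishes there: otherwise a small step from \<open>v\<close> along \<open>- A v\<close> would make
  the form negative.\<close>

lemma psd_quadratic_form_zero:
  fixes A :: "real ^ 'n ^ 'n::finite"
  assumes sym: "transpose A = A" and psd: "\<And>x. 0 \<le> x \<bullet> (A *v x)"
    and zero: "v \<bullet> (A *v v) = 0"
  shows "A *v v = 0"
proof (rule ccontr)
  assume "A *v v \<noteq> 0"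
  define w where "w = A *v v"
  define s where "s = w \<bullet> w"
  define c where "c = w \<bullet> (A *v w)"
  \<comment> \<open>The form at \<open>v - r w\<close> is \<open>r (r c - 2 s)\<close>, which is
    negative once \<open>r c < 2 s\<close>; the \<open>+ 1\<close> keeps the denominator positive if
    \<open>c = 0\<close>.\<close>
  define r where "r = s / (c + 1)"
  have s: "0 < s" using \<open>A *v v \<noteq> 0\<close> by (simp add: s_def w_def)
  have c: "0 \<le> c" unfolding c_def by (rule psd)
  have r: "0 < r" using s c by (simp add: r_def)
  have "v \<bullet> (A *v w) = s"
    using symmetric_matrix_inner[OF sym, of v w] by (simp add: s_def w_def)
  moreover have "w \<bullet> (A *v v) = s" by (simp add: s_def w_def)
  ultimately have "(v - r *\<^sub>R w) \<bullet> (A *v (v - r *\<^sub>R w)) = r * (r * c - 2 * s)"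
    using zero
    by (simp add: matrix_vector_mult_diff_distrib matrix_vector_mult_scaleR inner_diff_left
        inner_diff_right c_def algebra_simps)
  then have "0 \<le> r * (r * c - 2 * s)" using psd by metis
  then have "2 * s \<le> r * c" using r by (simp add: zero_le_mult_iff)
  moreover have "r * (c + 1) = s" using c by (simp add: r_def)
  ultimately show False using r s by (simp add: algebra_simps)
qed

text \<open>The largest eigenvalue is the maximum of the quadratic form on the unit sphere.\<close>

lemma real_spectrum_symmetric_nonempty:
  fixes A :: "real ^ 'n ^ 'n::finite"
  assumes sym: "transpose A = A"
  shows "real_spectrum A \<noteq> {}"
proof -
  have "continuous_on (sphere 0 1) (\<lambda>x. x \<bullet> (A *v x))"
    by (intro continuous_intros linear_continuous_on matrix_vector_mul_bounded_linear)
  moreover have "compact (sphere (0 :: real ^ 'n) 1)" "sphere (0 :: real ^ 'n) 1 \<noteq> {}" by simp_all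
  ultimately obtain v where v: "norm v = 1"
    and max: "\<And>x. norm x = 1 \<Longrightarrow> x \<bullet> (A *v x) \<le> v \<bullet> (A *v v)"
    using continuous_attains_sup by (metis (no_types, lifting) mem_sphere_0)
  define \<mu> where "\<mu> = v \<bullet> (A *v v)"
  \<comment> \<open>By maximality of \<mu> this matrix is positive semidefinite, and its form
    vanishes at \<open>v\<close>; so \<open>v\<close> lies in its kernel.\<close>
  define M where "M = \<mu> *\<^sub>R mat 1 - A"
  have M: "M *v x = \<mu> *\<^sub>R x - A *v x" for x
    by (simp add: M_def matrix_vector_mult_diff_rdistrib scaleR_matrix_vector_assoc[symmetric])
  have "A $ i $ j = A $ j $ i" for i j
    by (metis sym transpose_def vec_lambda_beta)
  then have "transpose M = M"
    by (simp add: vec_eq_iff transpose_def M_def mat_def)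
  moreover have "0 \<le> x \<bullet> (M *v x)" for x
  proof (cases "x = 0")
    case False
    \<comment> \<open>Homogeneity reduces the claim to the unit sphere.\<close>
    then have "(x /\<^sub>R norm x) \<bullet> (A *v (x /\<^sub>R norm x)) \<le> \<mu>"
      unfolding \<mu>_def by (intro max) simp
    then show ?thesis using False
      by (simp add: M inner_diff_right matrix_vector_mult_scaleR dot_square_norm field_simps power2_eq_square)
  qed simp
  moreover have "v \<bullet> (M *v v) = 0"
    using v by (simp add: M inner_diff_right \<mu>_def dot_square_norm)
  ultimately have "M *v v = 0" by (rule psd_quadratic_form_zero)
  then have "A *v v = \<mu> *\<^sub>R v" by (simp add: M)
  moreover have "v \<noteq> 0" using v by auto
  ultimately show ?thesis by (auto simp: real_spectrum_def)
qed

section \<open>Galerkin matrices\<close>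

lemma galerkin_matrix_nth:
  "galerkin_matrix \<rho> \<phi> y $ l $ m =
     (\<Sum>k\<in>UNIV. y $ k * rho_inner \<rho> (\<phi> k) (\<lambda>s. \<phi> l s * \<phi> m s))"
  by (simp add: galerkin_matrix_def sum_component)

lemma transpose_galerkin_matrix: "transpose (galerkin_matrix \<rho> \<phi> y) = galerkin_matrix \<rho> \<phi> y"
  by (simp add: vec_eq_iff transpose_def galerkin_matrix_nth mult.commute)

lemma galerkin_matrix_add:
  "galerkin_matrix \<rho> \<phi> (x + y) = galerkin_matrix \<rho> \<phi> x + galerkin_matrix \<rho> \<phi> y"
  by (simp add: vec_eq_iff galerkin_matrix_nth sum.distrib algebra_simps)

lemma galerkin_matrix_scaleR: "galerkin_matrix \<rho> \<phi> (c *\<^sub>R y) = c *\<^sub>R galerkin_matrix \<rho> \<phi> y"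
  by (simp add: vec_eq_iff galerkin_matrix_nth sum_distrib_left mult.assoc)

lemma galerkin_matrix_0 [simp]: "galerkin_matrix \<rho> \<phi> 0 = 0"
  by (simp add: vec_eq_iff galerkin_matrix_nth)

text \<open>Both sides contract the integrals of \<open>\<phi> k * \<phi> l * \<phi> m\<close>
  against \<rho>, which are symmetric in all three indices, with \<open>x\<close> and
  \<open>y\<close>.\<close>

lemma galerkin_matrix_commute: "galerkin_matrix \<rho> \<phi> x *v y = galerkin_matrix \<rho> \<phi> y *v x"
proof -
  have eq: "x $ k * rho_inner \<rho> (\<phi> k) (\<lambda>s. \<phi> l s * \<phi> m s) * y $ m =
      y $ m * rho_inner \<rho> (\<phi> m) (\<lambda>s. \<phi> l s * \<phi> k s) * x $ k" for k l m
    by (simp add: rho_inner_def mult_ac)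
  have "(galerkin_matrix \<rho> \<phi> x *v y) $ l = (galerkin_matrix \<rho> \<phi> y *v x) $ l" for l
  proof -
    have "(galerkin_matrix \<rho> \<phi> x *v y) $ l =
        (\<Sum>m\<in>UNIV. \<Sum>k\<in>UNIV. x $ k * rho_inner \<rho> (\<phi> k) (\<lambda>s. \<phi> l s * \<phi> m s) * y $ m)"
      by (simp add: matrix_vector_mult_def galerkin_matrix_nth sum_distrib_right)
    also have "\<dots> = (\<Sum>m\<in>UNIV. \<Sum>k\<in>UNIV. y $ m * rho_inner \<rho> (\<phi> m) (\<lambda>s. \<phi> l s * \<phi> k s) * x $ k)"
      by (intro sum.cong refl eq)
    also have "\<dots> = (\<Sum>k\<in>UNIV. \<Sum>m\<in>UNIV. y $ m * rho_inner \<rho> (\<phi> m) (\<lambda>s. \<phi> l s * \<phi> k s) * x $ k)"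
      by (rule sum.swap)
    also have "\<dots> = (galerkin_matrix \<rho> \<phi> y *v x) $ l"
      by (simp add: matrix_vector_mult_def galerkin_matrix_nth sum_distrib_right)
    finally show ?thesis .
  qed
  then show ?thesis by (simp add: vec_eq_iff)
qed

lemma galerkin_matrix_diff_squares:
  "galerkin_matrix \<rho> \<phi> a *v a - galerkin_matrix \<rho> \<phi> b *v b = galerkin_matrix \<rho> \<phi> (a + b) *v (a - b)"
  by (simp add: galerkin_matrix_add algebra_simps galerkin_matrix_commute[of _ _ a b])

section \<open>Flux and Jacobian at zero discharge\<close>

lemma hpart_stack [simp]: "hpart (stack h q) = h"
  by (simp add: hpart_def stack_def)

lemma qpart_stack [simp]: "qpart (stack h q) = q"
  by (simp add: qpart_def stack_def)

lemma stack_hpart_qpart [simp]: "stack (hpart U) (qpart U) = U"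
  by (simp add: vec_eq_iff hpart_def qpart_def stack_def split: sum.split)

lemma stack_eq_iff [simp]: "stack a b = stack c d \<longleftrightarrow> a = c \<and> b = d"
  by (metis hpart_stack qpart_stack)

lemma stack_0 [simp]: "stack 0 0 = 0"
  by (simp add: vec_eq_iff stack_def split: sum.split)

lemma stack_eq_0_iff [simp]: "stack a b = 0 \<longleftrightarrow> a = 0 \<and> b = 0"
  by (metis stack_0 stack_eq_iff)

lemma stack_add: "stack a b + stack c d = stack (a + c) (b + d)"
  by (simp add: vec_eq_iff stack_def split: sum.split)

lemma stack_diff: "stack a b - stack c d = stack (a - c) (b - d)"
  by (simp add: vec_eq_iff stack_def split: sum.split)

lemma stack_scaleR: "r *\<^sub>R stack a b = stack (r *\<^sub>R a) (r *\<^sub>R b)"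
  by (simp add: vec_eq_iff stack_def split: sum.split)

lemma stack_uminus: "- stack a b = stack (- a) (- b)"
  by (simp add: vec_eq_iff stack_def split: sum.split)

lemma block_matrix_mult_stack:
  "block_matrix A B C D *v stack x y = stack (A *v x + B *v y) (C *v x + D *v y)"
proof -
  have UNIV_sum: "(\<Sum>i\<in>UNIV. f i) = (\<Sum>a\<in>UNIV. f (Inl a)) + (\<Sum>b\<in>UNIV. f (Inr b))"
    for f :: "'a + 'a \<Rightarrow> real"
    by (subst UNIV_Plus_UNIV[symmetric], subst sum.Plus) simp_all
  show ?thesis
    by (simp add: vec_eq_iff matrix_vector_mult_def block_matrix_def stack_def UNIV_sum split: sum.split)
qed

lemma swe_flux_rest:
  "swe_flux (galerkin_matrix \<rho> \<phi>) g (stack h 0) = stack 0 ((g / 2) *\<^sub>R (galerkin_matrix \<rho> \<phi> h *v h))"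
  by (simp add: swe_flux_def Let_def)

text \<open>For \<open>q = 0\<close> also \<open>u = 0\<close>, and \<open>P 0 = 0\<close> leaves
  only the blocks \<open>mat 1\<close> and \<open>g *\<^sub>R P h\<close>.\<close>

lemma swe_jacobian_rest:
  "swe_jacobian (galerkin_matrix \<rho> \<phi>) g (stack h 0) *v stack x y =
     stack y (g *\<^sub>R (galerkin_matrix \<rho> \<phi> h *v x))"
  by (simp add: swe_jacobian_def Let_def block_matrix_mult_stack scaleR_matrix_vector_assoc)

text \<open>The first block row forces an eigenvector to be \<open>(x, \<nu> x)\<close>; the second
  then reads \<open>g A x = \<nu>\<^sup>2 x\<close>.\<close>

lemma real_spectrum_jacobian_rest:
  assumes "0 < g"
  shows "\<nu> \<in> real_spectrum (swe_jacobian (galerkin_matrix \<rho> \<phi>) g (stack h 0)) \<longleftrightarrow>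
    \<nu>\<^sup>2 / g \<in> real_spectrum (galerkin_matrix \<rho> \<phi> h)"
    (is "\<nu> \<in> real_spectrum ?J \<longleftrightarrow> _ \<in> real_spectrum ?A")
proof
  assume "\<nu> \<in> real_spectrum ?J"
  then obtain V where V: "V \<noteq> 0" "?J *v V = \<nu> *\<^sub>R V"
    by (auto simp: real_spectrum_def)
  define x y where "x = hpart V" and "y = qpart V"
  have [simp]: "V = stack x y" by (simp add: x_def y_def)
  have y: "y = \<nu> *\<^sub>R x" and "g *\<^sub>R (?A *v x) = \<nu> *\<^sub>R y"
    using V(2) by (simp_all add: swe_jacobian_rest stack_scaleR)
  then have "?A *v x = (\<nu>\<^sup>2 / g) *\<^sub>R x"
    using assms by (simp add: vec_eq_iff power2_eq_square field_simps)
  moreover have "x \<noteq> 0" using V(1) y by auto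
  ultimately show "\<nu>\<^sup>2 / g \<in> real_spectrum ?A" by (auto simp: real_spectrum_def)
next
  assume "\<nu>\<^sup>2 / g \<in> real_spectrum ?A"
  then obtain x where x: "x \<noteq> 0" "?A *v x = (\<nu>\<^sup>2 / g) *\<^sub>R x"
    by (auto simp: real_spectrum_def)
  have "?J *v stack x (\<nu> *\<^sub>R x) = \<nu> *\<^sub>R stack x (\<nu> *\<^sub>R x)"
    using assms x(2) by (simp add: swe_jacobian_rest stack_scaleR power2_eq_square)
  then show "\<nu> \<in> real_spectrum ?J"
    using x(1) by (auto simp: real_spectrum_def intro!: exI[of _ "stack x (\<nu> *\<^sub>R x)"])
qed

text \<open>This makes \<open>a\<^sup>+\<close> strictly positive, while \<open>a\<^sup>-\<close> is
  at most 0 by definition.\<close>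

lemma largest_eigenvalue_jacobian_rest_pos:
  assumes g: "0 < g" and pos: "positive_definite (galerkin_matrix \<rho> \<phi> h)"
  shows "0 < largest_eigenvalue (swe_jacobian (galerkin_matrix \<rho> \<phi>) g (stack h 0))"
    (is "0 < largest_eigenvalue ?J")
proof -
  let ?A = "galerkin_matrix \<rho> \<phi> h"
  have sym: "transpose ?A = ?A" by (rule transpose_galerkin_matrix)
  obtain \<mu> where \<mu>: "\<mu> \<in> real_spectrum ?A"
    using real_spectrum_symmetric_nonempty[OF sym] by blast
  then obtain x where x: "x \<noteq> 0" "?A *v x = \<mu> *\<^sub>R x"
    by (auto simp: real_spectrum_def)
  then have "0 < \<mu> * (x \<bullet> x)"
    using pos by (metis inner_scaleR_right positive_definite_def)
  then have "0 < \<mu>" using x(1) by (metis inner_gt_zero_iff zero_less_mult_pos2)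
  then have elem: "sqrt (g * \<mu>) \<in> real_spectrum ?J"
    using \<mu> g by (simp add: real_spectrum_jacobian_rest)
  \<comment> \<open>\<open>Max\<close> bounds the elements of a finite set only, so the spectrum of
    the Jacobian is covered by the square roots coming from the finite spectrum of
    \<open>?A\<close>.\<close>
  have "real_spectrum ?J \<subseteq> (\<Union>\<mu>\<in>real_spectrum ?A. {sqrt (g * \<mu>), - sqrt (g * \<mu>)})"
  proof
    fix \<nu> assume "\<nu> \<in> real_spectrum ?J"
    then have "\<nu>\<^sup>2 / g \<in> real_spectrum ?A" using g by (simp add: real_spectrum_jacobian_rest)
    moreover have "sqrt (g * (\<nu>\<^sup>2 / g)) = \<bar>\<nu>\<bar>" using g by simp
    ultimately show "\<nu> \<in> (\<Union>\<mu>\<in>real_spectrum ?A. {sqrt (g * \<mu>), - sqrt (g * \<mu>)})"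
      by (intro UN_I[of "\<nu>\<^sup>2 / g"]) (auto simp: abs_if)
  qed
  then have "finite (real_spectrum ?J)"
    by (rule finite_subset) (simp add: finite_real_spectrum_symmetric[OF sym])
  then have "sqrt (g * \<mu>) \<le> largest_eigenvalue ?J"
    unfolding largest_eigenvalue_def using elem by (rule Max_ge)
  moreover have "0 < sqrt (g * \<mu>)" using g \<open>0 < \<mu>\<close> by simp
  ultimately show ?thesis by linarith
qed

section \<open>Lake at rest\<close>

lemma slope_const:
  assumes "V (i - 1) = c" "V i = c" "V (i + 1) = c"
  shows "slope \<theta> dx V i = 0"
  using assms by (simp add: slope_def minmod_def vec_eq_iff)

lemma rec_minus_const:
  assumes "V (i - 1) = c" "V i = c" "V (i + 1) = c"
  shows "rec_minus \<theta> dx V i = c"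
  using assms by (simp add: rec_minus_def slope_const)

lemma rec_plus_const:
  assumes "V i = c" "V (i + 1) = c" "V (i + 2) = c"
  shows "rec_plus \<theta> dx V i = c"
proof -
  \<comment> \<open>The right state at interface \<open>i\<close> uses the slope of cell
    \<open>i + 1\<close>, whose stencil ends at \<open>i + 2\<close>.\<close>
  have "slope \<theta> dx V (i + 1) = 0"
    by (rule slope_const[where c = c]) (use assms in \<open>simp_all add: add.assoc\<close>)
  then show ?thesis using assms by (simp add: rec_plus_def)
qed

lemma numerical_flux_rest:
  assumes g: "0 < g"
    and surface: "\<And>j. j \<in> {i - 1..i + 2} \<Longrightarrow> surface_avg B U j = w"
    and discharge: "\<And>j. j \<in> {i - 1..i + 2} \<Longrightarrow> qpart (U j) = 0"
    and pos: "positive_definite (galerkin_matrix \<rho> \<phi> (w - B i))"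
  shows "numerical_flux (galerkin_matrix \<rho> \<phi>) g \<theta> dx B U i =
    stack 0 ((g / 2) *\<^sub>R (galerkin_matrix \<rho> \<phi> (w - B i) *v (w - B i)))"
proof -
  let ?P = "galerkin_matrix \<rho> \<phi>" and ?V = "stack (w - B i) 0"
  define ap am where "ap = speed_plus ?P g ?V ?V" and "am = speed_minus ?P g ?V ?V"
  have "U_minus \<theta> dx B U i = ?V"
    by (simp add: U_minus_def rec_minus_const[where c = w] rec_minus_const[where c = 0] surface discharge)
  moreover have "U_plus \<theta> dx B U i = ?V"
    by (simp add: U_plus_def rec_plus_const[where c = w] rec_plus_const[where c = 0] surface discharge)
  moreover have "0 < ap"
    using largest_eigenvalue_jacobian_rest_pos[OF g pos] by (simp add: ap_def speed_plus_def)
  moreover have "am \<le> 0" by (simp add: am_def speed_minus_def)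
  \<comment> \<open>Equal states kill the jump term, and the factor \<open>ap - am > 0\<close>
    cancels.\<close>
  ultimately have "numerical_flux ?P g \<theta> dx B U i = swe_flux ?P g ?V"
    by (simp add: numerical_flux_def Let_def ap_def[symmetric] am_def[symmetric]
        scaleR_left_diff_distrib[symmetric])
  then show ?thesis by (simp add: swe_flux_rest)
qed

text \<open>The range \<open>i - 2..i + 2\<close> is the union of the stencils of the interfaces
  \<open>i - 1\<close> and \<open>i\<close>.\<close>

lemma scheme_rhs_rest:
  assumes "0 < g"
    and surface: "\<And>j. j \<in> {i - 2..i + 2} \<Longrightarrow> surface_avg B U j = w"
    and discharge: "\<And>j. j \<in> {i - 2..i + 2} \<Longrightarrow> qpart (U j) = 0"
    and pos: "positive_definite (galerkin_matrix \<rho> \<phi> (w - B (i - 1)))"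
      "positive_definite (galerkin_matrix \<rho> \<phi> (w - B i))"
  shows "scheme_rhs (galerkin_matrix \<rho> \<phi>) g \<theta> dx B U i = 0"
proof -
  let ?P = "galerkin_matrix \<rho> \<phi>"
  define a b where "a = w - B i" and "b = w - B (i - 1)"
  have "hpart (U i) + bottom_avg B i = w" using surface[of i] by (simp add: surface_avg_def)
  then have "hpart (U i) = w - bottom_avg B i" by (simp add: algebra_simps)
  \<comment> \<open>The piecewise linear bottom makes the cell average the mean of the interface
    values; its factor \<open>1 / 2\<close> turns \<open>g\<close> in the source into the
    \<open>g / 2\<close> of the flux.\<close>
  also have "\<dots> = (1 / 2) *\<^sub>R (a + b)"
    by (simp add: bottom_avg_def a_def b_def vec_eq_iff field_simps)
  finally have h: "hpart (U i) = (1 / 2) *\<^sub>R (a + b)" .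
  have jump: "B i - B (i - 1) = - (a - b)" by (simp add: a_def b_def)
  have "numerical_flux ?P g \<theta> dx B U i = stack 0 ((g / 2) *\<^sub>R (?P a *v a))"
    unfolding a_def using assms by (intro numerical_flux_rest) auto
  moreover have "numerical_flux ?P g \<theta> dx B U (i - 1) = stack 0 ((g / 2) *\<^sub>R (?P b *v b))"
    unfolding b_def using assms by (intro numerical_flux_rest) auto
  ultimately have "numerical_flux ?P g \<theta> dx B U i - numerical_flux ?P g \<theta> dx B U (i - 1)
      = stack 0 ((g / 2) *\<^sub>R (?P (a + b) *v (a - b)))"
    by (simp add: stack_diff scaleR_diff_right[symmetric] galerkin_matrix_diff_squares)
  moreover have "source_term ?P g dx B U i = stack 0 ((1 / dx) *\<^sub>R (g / 2) *\<^sub>R (?P (a + b) *v (a - b)))"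
    unfolding source_term_def h jump galerkin_matrix_scaleR
    by (simp add: scaleR_matrix_vector_assoc[symmetric] matrix_vector_mult_diff_distrib
        scaleR_diff_right)
  ultimately show ?thesis
    by (simp add: scheme_rhs_def stack_add stack_scaleR stack_uminus)
qed

text \<open>The interfaces \<open>0..N\<close> of the cells \<open>1..N\<close> draw on cells
  \<open>-1..N + 2\<close>, and the bottom average of cell \<open>-1\<close> on interface
  \<open>-2\<close>. The second conjunct passes from the right-hand side to the time derivative of a
  solution.\<close>

theorem lemma4p1:
  fixes \<rho> :: "real ^ 'd::finite \<Rightarrow> real"
    and \<Lambda> :: "('d \<Rightarrow> nat) set"
    and \<phi> :: "'k::finite \<Rightarrow> real ^ 'd \<Rightarrow> real"
    and k1 :: 'k
    and g \<theta> dx xL :: real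
    and N :: int
    and bottom :: "real \<Rightarrow> real ^ 'd \<Rightarrow> real"
    and P :: "real ^ 'k \<Rightarrow> real ^ 'k ^ 'k"
    and B :: "int \<Rightarrow> real ^ 'k"
    and U :: "real \<Rightarrow> int \<Rightarrow> real ^ ('k + 'k)"
    and T :: "real set"
    and t :: real
    and wstar :: "real ^ 'k"
  assumes rho: "density_with_moments \<rho>"
    and Lam: "finite \<Lambda>" "(\<lambda>_. 0) \<in> \<Lambda>" "card \<Lambda> = CARD('k)"
    and basis: "orthonormal_basis_of \<rho> \<Lambda> \<phi>" "\<phi> k1 = (\<lambda>_. 1)"
    and P: "P = galerkin_matrix \<rho> \<phi>"
    and params: "0 < g" "0 < dx" "1 \<le> \<theta>" "\<theta> \<le> 2" "1 \<le> N"
    and bottom: "\<And>i. i \<in> {-2..N + 2} \<Longrightarrow> bottom (xL + of_int i * dx) \<in> borel_measurable lebesgue"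
      "\<And>i. i \<in> {-2..N + 2} \<Longrightarrow> integrable lebesgue (\<lambda>s. (bottom (xL + of_int i * dx) s)\<^sup>2 * \<rho> s)"
    and B: "B = (\<lambda>i. proj_coeffs \<rho> \<phi> (bottom (xL + of_int i * dx)))"
    and rest: "\<And>i. i \<in> {-1..N + 2} \<Longrightarrow> hpart (U t i) + bottom_avg B i = wstar"
      "\<And>i. i \<in> {-1..N + 2} \<Longrightarrow> qpart (U t i) = 0"
    and pos: "\<And>i. i \<in> {0..N} \<Longrightarrow> positive_definite (P (wstar - B i))"
  shows "(\<forall>i\<in>{1..N}. scheme_rhs P g \<theta> dx B (U t) i = 0) \<and>
         (scheme_solution P g \<theta> dx B N T U \<and> t \<in> T \<longrightarrow>
           (\<forall>i\<in>{1..N}. ((\<lambda>\<tau>. U \<tau> i) has_vector_derivative 0) (at t within T)))"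
proof -
  have zero: "scheme_rhs P g \<theta> dx B (U t) i = 0" if "i \<in> {1..N}" for i
    unfolding P
  proof (rule scheme_rhs_rest[where w = wstar])
    show "positive_definite (galerkin_matrix \<rho> \<phi> (wstar - B (i - 1)))"
      "positive_definite (galerkin_matrix \<rho> \<phi> (wstar - B i))"
      using that pos by (auto simp: P)
  qed (use that params rest in \<open>auto simp: surface_avg_def\<close>)
  then show ?thesis
    by (auto simp: scheme_solution_def)
qed

end
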